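(* Let $\mathcal P$ be an infinite set of prime numbers, and let $\varepsilon$ and $\kappa$ be positive real numbers with $\kappa<1$. Let $\{a_n\}_{n=1}^\infty$ and $\{b_n\}_{n=1}^\infty$ be sequences of non-zero integers such that for each $p\in\mathcal P$: $p\nmid\gcd(a_n,b_n)$ for all $n$, and the sequence $\{\nu_p(a_n)\}_n$ is bounded and attains its maximum value for exactly one $n$. Suppose that $a_{n+1}\ge a_n\ge n^{1+\varepsilon}$ and $|b_n|\le 2^{(\log_2|a_n|)^\kappa}$ for all $n$. Then the sequence $\{a_n/b_n\}$ is $\mathcal P$-irrational if $\limsup_{n\to\infty}|a_n|^{1/2^n}=\infty$, and it is $\mathcal P$-transcendental if $\limsup_{n\to\infty}a_n^{1/A^n}=\infty$ for every positive integer $A$.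
   Context: $\nu_p$ denotes the $p$-adic valuation. For a set $\mathcal P$ of primes, a sequence $\{x_n\}_{n=1}^\infty$ of non-zero numbers is $\mathcal P$-irrational (resp. $\mathcal P$-transcendental) if for every sequence of integers $\{c_n\}_{n=1}^\infty$ with $p\nmid c_n$ for all $p\in\mathcal P$ and all $n$, the series $\sum_{n=1}^\infty\frac{1}{x_nc_n}$ converges to an irrational (resp. transcendental) number. *)

theory Defs
  imports "HOL-Analysis.Analysis" "HOL-Computational_Algebra.Computational_Algebra"
begin

text \<open>Sequences are indexed from 1; values at index 0 are irrelevant.
  A sequence x of non-zero reals is P-irrational if for every integer sequence c
  with no c n divisible by any prime of P, the series sum_{n>=1} 1/(x n * c n)
  converges to an irrational number.\<close>

definition P_irrational :: "nat set \<Rightarrow> (nat \<Rightarrow> real) \<Rightarrow> bool" where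
  "P_irrational P x \<longleftrightarrow> (\<forall>n\<ge>1. x n \<noteq> 0) \<and>
     (\<forall>c :: nat \<Rightarrow> int. (\<forall>n\<ge>1. \<forall>p\<in>P. \<not> int p dvd c n) \<longrightarrow>
        summable (\<lambda>n. 1 / (x (Suc n) * of_int (c (Suc n)))) \<and>
        (\<Sum>n. 1 / (x (Suc n) * of_int (c (Suc n)))) \<notin> \<rat>)"

definition P_transcendental :: "nat set \<Rightarrow> (nat \<Rightarrow> real) \<Rightarrow> bool" where
  "P_transcendental P x \<longleftrightarrow> (\<forall>n\<ge>1. x n \<noteq> 0) \<and>
     (\<forall>c :: nat \<Rightarrow> int. (\<forall>n\<ge>1. \<forall>p\<in>P. \<not> int p dvd c n) \<longrightarrow>
        summable (\<lambda>n. 1 / (x (Suc n) * of_int (c (Suc n)))) \<and>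
        \<not> algebraic (\<Sum>n. 1 / (x (Suc n) * of_int (c (Suc n)))))"

end

theory Submission
  imports Defs "HOL-Real_Asymp.Real_Asymp"
begin

text \<open>
  Absorbing \<open>c\<close> into \<open>a\<close> and \<open>b\<close> destroys the monotonicity of \<open>a\<close>, but the series converges
  absolutely and the denominators tend to infinity, so it may be rearranged by increasing denominator;
  the rearranged denominators still dominate \<open>a\<close> termwise, hence keep its growth.

  If the sum is a root of a non-zero integer polynomial of degree at most \<open>D\<close>, then a Liouville
  estimate bounds \<open>Q\<^sub>N ^ D * R\<^sub>N\<close> away from 0 for all large \<open>N\<close>, where \<open>Q\<^sub>N\<close> is the product of
  the first \<open>N\<close> denominators and \<open>R\<^sub>N\<close> the tail of the absolute values. This needs that the partial
  sums are eventually not roots of the polynomial: a large prime of \<open>P\<close> divides the reduced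
  denominator of every late partial sum, because its valuation is maximal at exactly one index.

  On the other hand, writing \<open>L\<close> for the binary logarithms of the denominators, \<open>s\<^sub>N\<close> for their
  partial sums and \<open>B = D + 1\<close>, the product \<open>Q\<^sub>N ^ D * R\<^sub>N\<close> gets arbitrarily small. Choose
  \<open>k \<le> T\<close> such that \<open>L\<close> is at least linear on \<open>[k, T]\<close> and \<open>L\<^sub>T\<close> is huge compared with
  \<open>s\<^sub>k * B ^ (T - k)\<close>. For \<open>N\<close> in \<open>[k, T]\<close> the tail is at most a constant times
  \<open>2 ^ (L\<^sub>N ^ \<beta> - L\<^sub>N) + 2 ^ (- \<delta> L\<^sub>T)\<close>, and if every such \<open>N\<close> had \<open>D s\<^sub>N\<close> above
  \<open>L\<^sub>N - L\<^sub>N ^ \<beta>\<close> or above \<open>\<delta> L\<^sub>T\<close>, up to a constant, then \<open>s\<close> could grow by hardly more than the factor \<open>B\<close> per step and \<open>L\<^sub>T\<close> would be too small.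
  If \<open>L\<close> is eventually at least linear, a fixed \<open>k\<close> works; otherwise \<open>k\<close> follows the last index
  before \<open>T\<close> where \<open>L\<close> is below linear, which makes \<open>s\<^sub>k \<le> k\<^sup>2\<close> negligible against \<open>B ^ k\<close>.
\<close>

section \<open>Estimates for powers and for tails of the weight series\<close>

lemma powr_le_mult_powr_plus_const:
  fixes \<kappa> \<beta> \<tau> :: real
  assumes "0 < \<kappa>" "\<kappa> < \<beta>" "0 < \<tau>"
  obtains c where "0 \<le> c" "\<And>x. 0 \<le> x \<Longrightarrow> x powr \<kappa> \<le> \<tau> * x powr \<beta> + c"
proof
  \<comment> \<open>The crossover point, where
    \<open>X powr \<kappa> = \<tau> * X powr \<beta>\<close>: beyond it the higher power dominates,
    below it \<open>X powr \<kappa>\<close> is a constant bound.\<close>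
  define X where "X = \<tau> powr (- 1 / (\<beta> - \<kappa>))"
  have X: "X > 0" using assms by (simp add: X_def)
  have X_powr: "X powr (\<kappa> - \<beta>) = \<tau>"
  proof -
    have "(- 1 / (\<beta> - \<kappa>)) * (\<kappa> - \<beta>) = 1" using assms by (simp add: field_simps)
    then show ?thesis unfolding X_def powr_powr using assms by simp
  qed
  show "0 \<le> X powr \<kappa>" by simp
  fix x :: real assume x: "0 \<le> x"
  show "x powr \<kappa> \<le> \<tau> * x powr \<beta> + X powr \<kappa>"
  proof (cases "x \<le> X")
    case True
    then have "x powr \<kappa> \<le> X powr \<kappa>" using x assms by (intro powr_mono2) auto
    moreover have "0 \<le> \<tau> * x powr \<beta>" using assms by simp
    ultimately show ?thesis by linarith
  next
    case False
    then have "x powr (\<kappa> - \<beta>) \<le> X powr (\<kappa> - \<beta>)"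
      using X assms by (intro powr_mono2') auto
    then have "x powr (\<kappa> - \<beta>) * x powr \<beta> \<le> \<tau> * x powr \<beta>"
      unfolding X_powr by (intro mult_right_mono) auto
    moreover have "x powr (\<kappa> - \<beta>) * x powr \<beta> = x powr \<kappa>"
      by (simp flip: powr_add)
    moreover have "0 \<le> X powr \<kappa>" by simp
    ultimately show ?thesis by linarith
  qed
qed

text \<open>With \<open>t = y / x\<close>, at least 1, the increment of the power is
  \<open>x powr \<beta> * (t powr \<beta> - 1)\<close> and that of the identity is
  \<open>x * (t - 1)\<close>; both factors of the former are at most those of the latter.\<close>

lemma powr_diff_le_diff:
  fixes x y \<beta> :: real
  assumes "1 \<le> x" "x \<le> y" "0 < \<beta>" "\<beta> < 1"
  shows "y powr \<beta> - y \<le> x powr \<beta> - x"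
proof -
  have "(y / x) powr \<beta> \<le> (y / x) powr 1"
    using assms by (intro powr_mono) (auto simp: field_simps)
  then have "x powr \<beta> * ((y / x) powr \<beta> - 1) \<le> x powr \<beta> * (y / x - 1)"
    using assms by (intro mult_left_mono) auto
  also have "\<dots> \<le> x * (y / x - 1)"
  proof (intro mult_right_mono)
    show "x powr \<beta> \<le> x" using powr_mono[of \<beta> 1 x] assms by simp
    show "0 \<le> y / x - 1" using assms by (simp add: field_simps)
  qed
  also have "x powr \<beta> * ((y / x) powr \<beta> - 1) = y powr \<beta> - x powr \<beta>"
    using assms by (simp add: powr_divide field_simps)
  also have "x * (y / x - 1) = y - x" using assms by (simp add: field_simps)
  finally show ?thesis by simp
qed

lemma summable_tail_series:
  fixes \<theta> :: real
  assumes "1 < \<theta>"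
  shows "summable (\<lambda>n. real (n + 1) powr - \<theta>)"
proof -
  have "summable (\<lambda>n. real n powr - \<theta>)" using assms by (subst summable_real_powr_iff) auto
  then show ?thesis by (subst (asm) summable_Suc_iff[symmetric]) simp
qed

text \<open>The exponent \<open>L n\<close> is split in three: one share \<delta> absorbs
  \<open>L n powr \<kappa>\<close>, another gives the decay in \<open>x\<close>, and the rest yields
  a summable weight because \<delta> is chosen with (1 - 2\<delta>)(1 + \<epsilon>) = 1 +
  \<epsilon>/2.\<close>

lemma term_bound_growth:
  fixes L :: "nat \<Rightarrow> real" and \<epsilon> \<kappa> \<delta> :: real
  assumes eps: "0 < \<epsilon>" and kappa: "0 < \<kappa>" "\<kappa> < 1"
    and delta: "\<delta> = \<epsilon> / (4 * (1 + \<epsilon>))"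
    and growth: "\<And>n. (1 + \<epsilon>) * log 2 (real (n + 1)) \<le> L n"
  obtains c where "\<And>n x. x \<le> L n \<Longrightarrow>
    2 powr (L n powr \<kappa> - L n) \<le> 2 powr c * 2 powr (- \<delta> * x) * real (n + 1) powr - (1 + \<epsilon> / 2)"
proof -
  have d: "0 < \<delta>" "1 - 2 * \<delta> = (1 + \<epsilon> / 2) / (1 + \<epsilon>)" using eps by (auto simp: delta field_simps)
  obtain c where c: "\<And>x. 0 \<le> x \<Longrightarrow> x powr \<kappa> \<le> \<delta> * x powr 1 + c"
    using powr_le_mult_powr_plus_const[of \<kappa> 1 \<delta>] kappa d by blast
  show thesis
  proof (rule that[of c])
    fix n x assume x: "x \<le> L n"
    have "0 \<le> (1 + \<epsilon>) * log 2 (real (n + 1))" using eps by simp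
    then have L0: "0 \<le> L n" using growth[of n] by linarith
    have *: "L n powr \<kappa> \<le> \<delta> * L n + c" using c[OF L0] L0 by simp
    have "(1 - 2 * \<delta>) * ((1 + \<epsilon>) * log 2 (real (n + 1))) \<le> (1 - 2 * \<delta>) * L n"
      using growth[of n] d eps by (intro mult_left_mono) auto
    moreover have "(1 - 2 * \<delta>) * ((1 + \<epsilon>) * log 2 (real (n + 1))) = (1 + \<epsilon> / 2) * log 2 (real (n + 1))"
      using eps unfolding d(2) by simp
    moreover have "\<delta> * x \<le> \<delta> * L n" using d x by simp
    ultimately have "L n powr \<kappa> - L n \<le> c + - \<delta> * x + log 2 (real (n + 1)) * - (1 + \<epsilon> / 2)"
      using * by (simp add: algebra_simps)
    then have "2 powr (L n powr \<kappa> - L n) \<le> 2 powr (c + - \<delta> * x + log 2 (real (n + 1)) * - (1 + \<epsilon> / 2))"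
      by simp
    also have "\<dots> = 2 powr c * 2 powr (- \<delta> * x) * (2 powr log 2 (real (n + 1))) powr - (1 + \<epsilon> / 2)"
      by (simp only: powr_add powr_powr)
    finally show "2 powr (L n powr \<kappa> - L n) \<le> 2 powr c * 2 powr (- \<delta> * x) * real (n + 1) powr - (1 + \<epsilon> / 2)"
      by simp
  qed
qed

text \<open>Where \<open>L\<close> is at least linear, a factor polynomial in \<open>n\<close> costs
  only a multiple of \<open>L n powr \<kappa>\<close>, which fits into
  \<open>L n powr \<beta>\<close>. Unlike the estimate from growth alone, this keeps the leading
  term \<open>- x\<close> of the exponent with coefficient 1.\<close>

lemma term_bound_linear:
  fixes L :: "nat \<Rightarrow> real" and \<kappa> \<beta> \<theta> :: real
  assumes kappa: "0 < \<kappa>" "\<kappa> < \<beta>" "\<beta> < 1" and theta: "0 < \<theta>"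
  obtains c where "\<And>n x. 1 \<le> x \<Longrightarrow> x \<le> L n \<Longrightarrow> real (n + 1) \<le> L n \<Longrightarrow>
    2 powr (L n powr \<kappa> - L n) \<le> 2 powr c * 2 powr (x powr \<beta> - x) * real (n + 1) powr - \<theta>"
proof -
  \<comment> \<open>The total multiple of \<open>L n powr \<kappa>\<close> to be absorbed: 1 from
    the numerator and the rest from \<theta> times the logarithm, by ln t \<le> t^\<kappa> /
    \<kappa>.\<close>
  define q where "q = 1 + \<theta> / (\<kappa> * ln 2)"
  have q: "q > 0" using kappa theta by (simp add: q_def add_pos_pos)
  obtain c where c: "\<And>x. 0 \<le> x \<Longrightarrow> x powr \<kappa> \<le> (1 / q) * x powr \<beta> + c"
    using powr_le_mult_powr_plus_const[of \<kappa> \<beta> "1 / q"] kappa q by auto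
  show thesis
  proof (rule that[of "q * c"])
    fix n x assume x: "1 \<le> x" "x \<le> L n" and n: "real (n + 1) \<le> L n"
    have "ln (L n) \<le> L n powr \<kappa> / \<kappa>" using x kappa by (intro ln_powr_bound) auto
    then have "\<theta> / ln 2 * ln (L n) \<le> \<theta> / ln 2 * (L n powr \<kappa> / \<kappa>)"
      using theta by (intro mult_left_mono) auto
    then have 1: "\<theta> * log 2 (L n) \<le> (q - 1) * L n powr \<kappa>"
      by (simp add: q_def log_def field_simps)
    have 2: "q * L n powr \<kappa> \<le> L n powr \<beta> + q * c"
      using mult_left_mono[OF c[of "L n"], of q] x q by (simp add: distrib_left)
    have 3: "L n powr \<beta> - L n \<le> x powr \<beta> - x"
      using x kappa by (intro powr_diff_le_diff) auto
    have "log 2 (real (n + 1)) \<le> log 2 (L n)" using n by simp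
    then have "\<theta> * log 2 (real (n + 1)) \<le> \<theta> * log 2 (L n)"
      using theta by (intro mult_left_mono) auto
    then have "L n powr \<kappa> - L n \<le> q * c + (x powr \<beta> - x) + log 2 (real (n + 1)) * - \<theta>"
      using 1 2 3 by (simp add: algebra_simps)
    then have "2 powr (L n powr \<kappa> - L n) \<le> 2 powr (q * c + (x powr \<beta> - x) + log 2 (real (n + 1)) * - \<theta>)"
      by simp
    also have "\<dots> = 2 powr (q * c) * 2 powr (x powr \<beta> - x) * (2 powr log 2 (real (n + 1))) powr - \<theta>"
      by (simp only: powr_add powr_powr)
    finally show "2 powr (L n powr \<kappa> - L n) \<le> 2 powr (q * c) * 2 powr (x powr \<beta> - x) * real (n + 1) powr - \<theta>"
      by simp
  qed
qed

lemma summable_weights: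
  fixes L :: "nat \<Rightarrow> real" and \<epsilon> \<kappa> :: real
  assumes eps: "0 < \<epsilon>" and kappa: "0 < \<kappa>" "\<kappa> < 1"
    and growth: "\<And>n. (1 + \<epsilon>) * log 2 (real (n + 1)) \<le> L n"
  shows "summable (\<lambda>n. 2 powr (L n powr \<kappa> - L n))"
proof -
  obtain c where c: "\<And>n x. x \<le> L n \<Longrightarrow> 2 powr (L n powr \<kappa> - L n) \<le>
      2 powr c * 2 powr (- (\<epsilon> / (4 * (1 + \<epsilon>))) * x) * real (n + 1) powr - (1 + \<epsilon> / 2)"
    using term_bound_growth[OF eps kappa refl growth] by blast
  have L0: "0 \<le> L n" for n
  proof -
    have "0 \<le> (1 + \<epsilon>) * log 2 (real (n + 1))" using eps by simp
    then show ?thesis using growth[of n] by linarith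
  qed
  show ?thesis
  proof (rule summable_comparison_test')
    show "summable (\<lambda>n. 2 powr c * real (n + 1) powr - (1 + \<epsilon> / 2))"
      using eps by (intro summable_mult summable_tail_series) auto
    show "norm (2 powr (L n powr \<kappa> - L n)) \<le> 2 powr c * real (n + 1) powr - (1 + \<epsilon> / 2)" for n
      using c[of 0 n] L0[of n] by simp
  qed
qed

text \<open>Indices up to \<open>T\<close> use the linear estimate with \<open>x = L N\<close>,
  later ones the growth estimate with \<open>x = L T\<close>. Bounding the weight at
  \<open>n + N\<close> by the one at \<open>n\<close> makes the constant independent of
  \<open>N\<close> and \<open>T\<close>.\<close>

lemma tail_bound:
  fixes L :: "nat \<Rightarrow> real" and \<epsilon> \<kappa> \<beta> \<delta> :: real
  assumes eps: "0 < \<epsilon>" and kappa: "0 < \<kappa>" "\<kappa> < \<beta>" "\<beta> < 1"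
    and delta: "\<delta> = \<epsilon> / (4 * (1 + \<epsilon>))"
    and mono: "mono L"
    and growth: "\<And>n. (1 + \<epsilon>) * log 2 (real (n + 1)) \<le> L n"
  obtains C where "0 < C" "\<And>N T. N \<le> T \<Longrightarrow> (\<And>n. N \<le> n \<Longrightarrow> n \<le> T \<Longrightarrow> real (n + 1) \<le> L n) \<Longrightarrow>
    (\<Sum>n. 2 powr (L (n + N) powr \<kappa> - L (n + N))) \<le>
      C * (2 powr (L N powr \<beta> - L N) + 2 powr (- \<delta> * L T))"
proof -
  define h where "h n = real (n + 1) powr - (1 + \<epsilon> / 2)" for n
  have kappa1: "\<kappa> < 1" using kappa by simp
  obtain c1 where c1: "\<And>n x. x \<le> L n \<Longrightarrow> 2 powr (L n powr \<kappa> - L n) \<le>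
      2 powr c1 * 2 powr (- \<delta> * x) * real (n + 1) powr - (1 + \<epsilon> / 2)"
    using term_bound_growth[OF eps kappa(1) kappa1 delta growth] by blast
  obtain c2 where c2: "\<And>n x. 1 \<le> x \<Longrightarrow> x \<le> L n \<Longrightarrow> real (n + 1) \<le> L n \<Longrightarrow>
    2 powr (L n powr \<kappa> - L n) \<le> 2 powr c2 * 2 powr (x powr \<beta> - x) * real (n + 1) powr - (1 + \<epsilon> / 2)"
    using term_bound_linear[OF kappa, of "1 + \<epsilon> / 2" L] eps by auto
  define c where "c = max c1 c2"
  have h: "summable h" unfolding h_def using eps by (intro summable_tail_series) auto
  have h0: "0 < h n" for n by (simp add: h_def)
  show thesis
  proof (rule that[of "2 powr c * suminf h"])
    show "0 < 2 powr c * suminf h" using suminf_pos[OF h] h0 by simp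
    fix N T assume NT: "N \<le> T" and lin: "\<And>n. N \<le> n \<Longrightarrow> n \<le> T \<Longrightarrow> real (n + 1) \<le> L n"
    define Y where "Y = 2 powr (L N powr \<beta> - L N) + 2 powr (- \<delta> * L T)"
    have bound: "2 powr (L (n + N) powr \<kappa> - L (n + N)) \<le> 2 powr c * Y * h n" for n
    proof -
      have hle: "real (n + N + 1) powr - (1 + \<epsilon> / 2) \<le> h n"
        unfolding h_def using eps by (intro powr_mono2') auto
      have fin: "2 powr c' * y * real (n + N + 1) powr - (1 + \<epsilon> / 2) \<le> 2 powr c * Y * h n"
        if "c' \<le> c" "0 \<le> y" "y \<le> Y" for c' y
        using that hle by (intro mult_mono) auto
      show ?thesis
      proof (cases "n + N \<le> T")
        case True
        have "1 \<le> L N" using lin[of N] NT by simp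
        then show ?thesis
          using True lin[of "n + N"] monoD[OF mono, of N "n + N"]
          by (intro order.trans[OF c2[of "L N" "n + N"] fin]) (auto simp: c_def Y_def)
      next
        case False
        then show ?thesis
          using monoD[OF mono, of T "n + N"]
          by (intro order.trans[OF c1[of "L T" "n + N"] fin]) (auto simp: c_def Y_def)
      qed
    qed
    have "(\<Sum>n. 2 powr (L (n + N) powr \<kappa> - L (n + N))) \<le> (\<Sum>n. 2 powr c * Y * h n)"
    proof (rule suminf_le[OF bound])
      show "summable (\<lambda>n. 2 powr (L (n + N) powr \<kappa> - L (n + N)))"
        using summable_ignore_initial_segment[OF summable_weights[OF eps kappa(1) kappa1 growth]] .
      show "summable (\<lambda>n. 2 powr c * Y * h n)" using h by (rule summable_mult)
    qed
    also have "\<dots> = 2 powr c * Y * suminf h" using suminf_mult[OF h] by simp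
    finally show "(\<Sum>n. 2 powr (L (n + N) powr \<kappa> - L (n + N))) \<le>
      2 powr c * suminf h * (2 powr (L N powr \<beta> - L N) + 2 powr (- \<delta> * L T))"
      by (simp add: Y_def mult_ac)
  qed
qed

section \<open>Finding a cut where the tail beats the denominators\<close>

text \<open>If no \<open>N\<close> works, \<open>L N\<close> stays below
  \<open>D * s N + C + L N powr \<beta>\<close>, so each step multiplies the partial sum
  \<open>s\<close> by about \<open>B = D + 1\<close>. Starting from \<sigma>, this keeps
  \<open>s (Suc T)\<close> below twice \<sigma> times \<open>B ^ Suc (T - k)\<close>, too small for
  the assumed size of \<open>L T\<close>.\<close>

lemma exists_gap:
  fixes L :: "nat \<Rightarrow> real" and \<beta> \<delta> C :: real and D :: nat
  assumes beta: "0 < \<beta>" "\<beta> < 1" and delta: "0 < \<delta>" and C: "1 \<le> C" and D: "1 \<le> D"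
    and L0: "\<And>n. 0 \<le> L n"
  obtains K \<sigma>\<^sub>0 where "0 < K" "\<forall>k T \<sigma>. \<sigma>\<^sub>0 \<le> \<sigma> \<longrightarrow> (\<Sum>n<k. L n) \<le> \<sigma> \<longrightarrow> k \<le> T \<longrightarrow>
      K * \<sigma> * real (D + 1) ^ (T - k) \<le> L T \<longrightarrow>
      (\<exists>N. k \<le> N \<and> N \<le> T \<and> real D * (\<Sum>n<N. L n) + C \<le> L N - L N powr \<beta> \<and>
        real D * (\<Sum>n<N. L n) + C \<le> \<delta> * L T)"
proof -
  define B where "B = real (D + 1)"
  have B: "B \<ge> 2" "B = real D + 1" using D by (auto simp: B_def)
  obtain c where c: "0 \<le> c" "\<And>x. 0 \<le> x \<Longrightarrow> x powr \<beta> \<le> (1 / 2) * x powr 1 + c"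
    using powr_le_mult_powr_plus_const[of \<beta> 1 "1 / 2"] beta by auto
  \<comment> \<open>Chosen so that the negated claim will give
    \<open>L (k + j) \<le> E * (\<sigma> * B ^ j)\<close>.\<close>
  define E where "E = (2 + 2 * c) * (2 * real D + C)"
  have E: "E \<ge> 1"
  proof -
    have "1 * 1 \<le> E" unfolding E_def using c C D by (intro mult_mono) auto
    then show ?thesis by simp
  qed
  have Bb: "B powr \<beta> < B" using powr_less_mono[of \<beta> 1 B] B beta by simp
  \<comment> \<open>Solves \<open>(C + E) * \<sigma> powr \<beta> \<le> \<sigma> * (B - B powr
    \<beta>)\<close>: from this size on, the lower-order error fits into the loss of the subtracted
    term in the inductive bound.\<close>
  define \<sigma>\<^sub>0 where "\<sigma>\<^sub>0 = max 1 (((C + E) / (B - B powr \<beta>)) powr (1 / (1 - \<beta>)))"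
  \<comment> \<open>The first summand makes the condition involving \<open>\<delta> * L T\<close>
    automatic throughout the induction; the others exceed \<open>2 * B\<close>, for the final
    contradiction.\<close>
  define K where "K = (2 * real D + C) / \<delta> + 2 * B + 1"
  have K: "0 < K" "(2 * real D + C) \<le> \<delta> * K" "2 * B < K"
  proof -
    have 0: "0 \<le> (2 * real D + C) / \<delta>" using C delta by simp
    show "0 < K" "2 * B < K" using 0 B unfolding K_def by linarith+
    have "\<delta> * K = 2 * real D + C + \<delta> * (2 * B + 1)" using delta by (simp add: K_def field_simps)
    moreover have "0 \<le> \<delta> * (2 * B + 1)" using delta B by simp
    ultimately show "(2 * real D + C) \<le> \<delta> * K" by linarith
  qed
  show thesis
  proof (rule that[of K \<sigma>\<^sub>0, OF K(1)], intro allI impI)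
    fix k T :: nat and \<sigma> :: real
    assume sigma: "\<sigma>\<^sub>0 \<le> \<sigma>" and sk: "(\<Sum>n<k. L n) \<le> \<sigma>" and kT: "k \<le> T"
      and LT: "K * \<sigma> * real (D + 1) ^ (T - k) \<le> L T"
    define s where "s N = (\<Sum>n<N. L n)" for N
    have s0: "0 \<le> s N" for N unfolding s_def using L0 by (intro sum_nonneg) auto
    have sig1: "1 \<le> \<sigma>" using sigma by (simp add: \<sigma>\<^sub>0_def)
    have sig2: "(C + E) * \<sigma> powr \<beta> \<le> \<sigma> * (B - B powr \<beta>)"
    proof -
      let ?q = "(C + E) / (B - B powr \<beta>)"
      have q: "0 < ?q" using C E Bb by simp
      have "?q powr (1 / (1 - \<beta>)) \<le> \<sigma>" using sigma by (simp add: \<sigma>\<^sub>0_def)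
      then have "(?q powr (1 / (1 - \<beta>))) powr (1 - \<beta>) \<le> \<sigma> powr (1 - \<beta>)"
        using beta by (intro powr_mono2) auto
      moreover have "(?q powr (1 / (1 - \<beta>))) powr (1 - \<beta>) = ?q"
        unfolding powr_powr using C E Bb beta by simp
      ultimately have "?q \<le> \<sigma> powr (1 - \<beta>)" by simp
      then have "?q * \<sigma> powr \<beta> \<le> \<sigma> powr (1 - \<beta>) * \<sigma> powr \<beta>"
        by (intro mult_right_mono) auto
      also have "\<dots> = \<sigma>" using sig1 by (simp flip: powr_add)
      finally show ?thesis using Bb by (simp add: field_simps)
    qed
    show "\<exists>N. k \<le> N \<and> N \<le> T \<and> real D * (\<Sum>n<N. L n) + C \<le> L N - L N powr \<beta> \<and>
        real D * (\<Sum>n<N. L n) + C \<le> \<delta> * L T"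
    proof (rule ccontr)
      assume neg: "\<not> ?thesis"
      \<comment> \<open>The subtracted term makes the bound a supersolution of \<open>s' = B * s + O(s powr \<beta>)\<close>.\<close>
      have "s (k + j) \<le> \<sigma> * (2 * B ^ j - (B ^ j) powr \<beta>)" if "j \<le> Suc (T - k)" for j
        using that
      proof (induction j)
        case 0
        then show ?case using sk by (simp add: s_def)
      next
        case (Suc j)
        let ?x = "L (k + j)" and ?y = "real D * s (k + j) + C"
        have IH: "s (k + j) \<le> \<sigma> * (2 * B ^ j - (B ^ j) powr \<beta>)" using Suc by simp
        have Bj: "1 \<le> B ^ j" using B by simp
        have "0 \<le> \<sigma> * (B ^ j) powr \<beta>" using sig1 by simp
        then have "s (k + j) \<le> 2 * \<sigma> * B ^ j" using IH by (simp add: algebra_simps)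
        then have "real D * s (k + j) \<le> real D * (2 * \<sigma> * B ^ j)" by (intro mult_left_mono) auto
        moreover have "C * 1 \<le> C * (\<sigma> * B ^ j)"
          using C sig1 Bj mult_mono[of 1 \<sigma> 1 "B ^ j"] by (intro mult_left_mono) auto
        ultimately have y: "?y \<le> (2 * real D + C) * (\<sigma> * B ^ j)" by (simp add: algebra_simps)
        also have "\<dots> \<le> (\<delta> * K) * (\<sigma> * B ^ (T - k))"
          using K sig1 B Suc.prems C by (intro mult_mono power_increasing) auto
        also have "\<dots> \<le> \<delta> * L T" using LT delta by (simp add: B_def mult_ac)
        finally have "?y \<le> \<delta> * L T" .
        \<comment> \<open>The \<delta>-condition holds here, so at \<open>k + j\<close> it is the
          other condition that fails.\<close>
        then have x: "?x < ?y + ?x powr \<beta>" using neg Suc.prems kT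
          by (auto simp: s_def not_le dest!: spec[of _ "k + j"])
        \<comment> \<open>Bootstrap: a crude linear bound on \<open>?x\<close> comes first, and is
          then fed back to show that \<open>?x powr \<beta>\<close> is of lower order.\<close>
        have "?x powr \<beta> \<le> ?x / 2 + c" using c(2)[OF L0[of "k + j"]] L0[of "k + j"] by simp
        then have "?x \<le> 2 * ?y + 2 * c" using x by simp
        also have "\<dots> \<le> 2 * ?y + 2 * c * ?y"
        proof -
          have "0 \<le> real D * s (k + j)" using s0[of "k + j"] by simp
          then have "1 \<le> ?y" using C by linarith
          then show ?thesis using mult_left_mono[of 1 ?y "2 * c"] c(1) by simp
        qed
        also have "\<dots> = (2 + 2 * c) * ?y" by (simp add: algebra_simps)
        also have "\<dots> \<le> (2 + 2 * c) * ((2 * real D + C) * (\<sigma> * B ^ j))"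
          using y c by (intro mult_left_mono) auto
        finally have "?x \<le> E * (\<sigma> * B ^ j)" by (simp add: E_def mult_ac)
        then have "?x powr \<beta> \<le> (E * (\<sigma> * B ^ j)) powr \<beta>"
          using L0 beta by (intro powr_mono2) auto
        also have "\<dots> = E powr \<beta> * (\<sigma> powr \<beta> * (B ^ j) powr \<beta>)"
          using E sig1 Bj by (simp add: powr_mult)
        also have "\<dots> \<le> E * (\<sigma> powr \<beta> * (B ^ j) powr \<beta>)"
          using powr_mono[of \<beta> 1 E] E beta by (intro mult_right_mono) auto
        finally have xb: "?x powr \<beta> \<le> E * (\<sigma> powr \<beta> * (B ^ j) powr \<beta>)" .
        have "1 * 1 \<le> \<sigma> powr \<beta> * (B ^ j) powr \<beta>"
          using sig1 Bj beta by (intro mult_mono ge_one_powr_ge_zero) auto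
        then have "C * 1 \<le> C * (\<sigma> powr \<beta> * (B ^ j) powr \<beta>)" using C by (intro mult_left_mono) auto
        then have "?x \<le> real D * s (k + j) + (C + E) * \<sigma> powr \<beta> * (B ^ j) powr \<beta>"
          using x xb by (simp add: algebra_simps)
        also have "\<dots> \<le> real D * s (k + j) + \<sigma> * (B - B powr \<beta>) * (B ^ j) powr \<beta>"
          using sig2 by (intro add_left_mono mult_right_mono) auto
        finally have "s (k + Suc j) \<le> B * s (k + j) + \<sigma> * (B - B powr \<beta>) * (B ^ j) powr \<beta>"
          by (simp add: s_def B(2) algebra_simps)
        also have "\<dots> \<le> B * (\<sigma> * (2 * B ^ j - (B ^ j) powr \<beta>)) + \<sigma> * (B - B powr \<beta>) * (B ^ j) powr \<beta>"
          using IH B by (intro add_right_mono mult_left_mono) auto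
        also have "\<dots> = \<sigma> * (2 * B ^ Suc j - (B ^ Suc j) powr \<beta>)"
          using B(1) by (simp add: powr_mult algebra_simps)
        finally show ?case .
      qed
      from this[of "Suc (T - k)"] kT
      have "s (Suc T) \<le> \<sigma> * (2 * B ^ Suc (T - k) - (B ^ Suc (T - k)) powr \<beta>)" by simp
      also have "\<dots> \<le> \<sigma> * (2 * B ^ Suc (T - k))" using sig1 by (intro mult_left_mono) auto
      finally have "L T \<le> 2 * B * (\<sigma> * B ^ (T - k))" using s0[of T] by (simp add: s_def mult_ac)
      also have "\<dots> < K * (\<sigma> * B ^ (T - k))" using K sig1 B by (intro mult_strict_right_mono) auto
      finally show False using LT by (simp add: B_def mult_ac)
    qed
  qed
qed

lemma exists_good_cut:
  fixes L :: "nat \<Rightarrow> real" and \<epsilon> \<kappa> \<eta> :: real and D N\<^sub>0 :: nat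
  assumes eps: "0 < \<epsilon>" and kappa: "0 < \<kappa>" "\<kappa> < 1" and D: "1 \<le> D" and eta: "0 < \<eta>"
    and mono: "mono L"
    and growth: "\<And>n. (1 + \<epsilon>) * log 2 (real (n + 1)) \<le> L n"
    and unbdd: "\<And>M m. \<exists>n\<ge>m. M * real (D + 1) ^ n \<le> L n"
  shows "\<exists>N\<ge>N\<^sub>0. 2 powr (real D * (\<Sum>n<N. L n)) * (\<Sum>n. 2 powr (L (n + N) powr \<kappa> - L (n + N))) < \<eta>"
proof -
  define \<beta> where "\<beta> = (1 + \<kappa>) / 2"
  define \<delta> where "\<delta> = \<epsilon> / (4 * (1 + \<epsilon>))"
  have beta: "\<kappa> < \<beta>" "\<beta> < 1" "0 < \<beta>" using kappa by (auto simp: \<beta>_def)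
  have delta: "0 < \<delta>" using eps by (simp add: \<delta>_def)
  have L0: "0 \<le> L n" for n
  proof -
    have "0 \<le> (1 + \<epsilon>) * log 2 (real (n + 1))" using eps by simp
    then show ?thesis using growth[of n] by linarith
  qed
  obtain C\<^sub>0 where C0: "0 < C\<^sub>0" and tail: "\<And>N T. N \<le> T \<Longrightarrow>
      (\<And>n. N \<le> n \<Longrightarrow> n \<le> T \<Longrightarrow> real (n + 1) \<le> L n) \<Longrightarrow>
      (\<Sum>n. 2 powr (L (n + N) powr \<kappa> - L (n + N))) \<le>
        C\<^sub>0 * (2 powr (L N powr \<beta> - L N) + 2 powr (- \<delta> * L T))"
    using tail_bound[OF eps kappa(1) beta(1,2) \<delta>_def mono growth] by blast
  \<comment> \<open>The margin \<open>C\<close> in the gap turns into a factor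
    \<open>2 powr - C\<close>, which must beat the two tail contributions of size
    \<open>C\<^sub>0\<close>.\<close>
  define C where "C = max 1 (log 2 (4 * C\<^sub>0 / \<eta>))"
  have C1: "1 \<le> C" by (simp add: C_def)
  have C2: "2 * C\<^sub>0 * 2 powr - C < \<eta>"
  proof -
    have "4 * C\<^sub>0 / \<eta> = 2 powr log 2 (4 * C\<^sub>0 / \<eta>)" using C0 eta by simp
    also have "\<dots> \<le> 2 powr C" by (simp add: C_def)
    finally have "2 * (2 * C\<^sub>0) \<le> 2 powr C * \<eta>" using eta by (simp add: field_simps)
    then have "2 * C\<^sub>0 < 2 powr C * \<eta>" using C0 by linarith
    then have "2 * C\<^sub>0 / 2 powr C < \<eta>" by (simp add: pos_divide_less_eq mult.commute)
    then show ?thesis by (simp add: powr_minus_divide)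
  qed
  obtain K \<sigma>\<^sub>0 where K: "0 < K" and gap: "\<forall>k T \<sigma>. \<sigma>\<^sub>0 \<le> \<sigma> \<longrightarrow> (\<Sum>n<k. L n) \<le> \<sigma> \<longrightarrow> k \<le> T \<longrightarrow>
      K * \<sigma> * real (D + 1) ^ (T - k) \<le> L T \<longrightarrow>
      (\<exists>N. k \<le> N \<and> N \<le> T \<and> real D * (\<Sum>n<N. L n) + C \<le> L N - L N powr \<beta> \<and>
        real D * (\<Sum>n<N. L n) + C \<le> \<delta> * L T)"
    by (rule exists_gap[OF beta(3,2) delta C1 D L0])
  \<comment> \<open>Reduces the claim to a window \<open>[k, T]\<close> on which \<open>L\<close> is
    at least linear and at whose end \<open>L T\<close> is huge; the two cases below only produce
    such windows.\<close>
  have main: ?thesis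
    if k: "N\<^sub>0 \<le> k" "k \<le> T" "(\<Sum>n<k. L n) \<le> \<sigma>" and sigma: "\<sigma>\<^sub>0 \<le> \<sigma>"
      and T: "K * \<sigma> * real (D + 1) ^ (T - k) \<le> L T"
      and lin: "\<And>n. k \<le> n \<Longrightarrow> n \<le> T \<Longrightarrow> real (n + 1) \<le> L n" for k T \<sigma>
  proof -
    obtain N where N: "k \<le> N" "N \<le> T" "real D * (\<Sum>n<N. L n) + C \<le> L N - L N powr \<beta>"
        "real D * (\<Sum>n<N. L n) + C \<le> \<delta> * L T"
      using gap[rule_format, OF sigma k(3,2) T] by blast
    let ?s = "real D * (\<Sum>n<N. L n)"
    have "2 powr ?s * (\<Sum>n. 2 powr (L (n + N) powr \<kappa> - L (n + N))) \<le>
        2 powr ?s * (C\<^sub>0 * (2 powr (L N powr \<beta> - L N) + 2 powr (- \<delta> * L T)))"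
      using N lin by (intro mult_left_mono tail) auto
    also have "\<dots> = C\<^sub>0 * (2 powr (?s + (L N powr \<beta> - L N)) + 2 powr (?s + - \<delta> * L T))"
      by (simp only: powr_add distrib_left mult.left_commute)
    also have "\<dots> \<le> C\<^sub>0 * (2 powr - C + 2 powr - C)"
      using N C0 by (intro mult_left_mono add_mono) auto
    also have "\<dots> < \<eta>" using C2 by simp
    finally show ?thesis using N k(1) by (intro exI[of _ N]) auto
  qed
  show ?thesis
  proof (cases "\<exists>m. \<forall>n\<ge>m. real (n + 1) \<le> L n")
    case True
    then obtain m where m: "\<And>n. m \<le> n \<Longrightarrow> real (n + 1) \<le> L n" by blast
    define k where "k = max m N\<^sub>0"
    define \<sigma> where "\<sigma> = max \<sigma>\<^sub>0 (\<Sum>n<k. L n)"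
    \<comment> \<open>With \<open>k\<close> and \<sigma> fixed, dividing by
      \<open>real (D + 1) ^ k\<close> turns the power \<open>T\<close> into
      \<open>T - k\<close>.\<close>
    obtain T where T: "k \<le> T" "K * \<sigma> / real (D + 1) ^ k * real (D + 1) ^ T \<le> L T"
      using unbdd by blast
    show ?thesis
    proof (rule main[of k T \<sigma>])
      have "K * \<sigma> / real (D + 1) ^ k * real (D + 1) ^ T = K * \<sigma> * real (D + 1) ^ (T - k)"
        using T(1) by (simp add: power_diff)
      then show "K * \<sigma> * real (D + 1) ^ (T - k) \<le> L T" using T(2) by simp
      show "real (n + 1) \<le> L n" if "k \<le> n" for n using m that by (auto simp: k_def)
    qed (use T in \<open>auto simp: k_def \<sigma>_def\<close>)
  next
    case False
    then have low: "\<exists>n\<ge>m. L n < real (n + 1)" for m by (auto simp: not_le)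
    have "(\<lambda>n. real n ^ 2 / 2 ^ n) \<longlonglongrightarrow> 0" by real_asymp
    then have "\<forall>\<^sub>F n in sequentially. real n ^ 2 / 2 ^ n < 1 / K"
      using K by (intro order_tendstoD) auto
    moreover have "\<forall>\<^sub>F n in sequentially. \<sigma>\<^sub>0 \<le> real n ^ 2" by real_asymp
    ultimately have "\<forall>\<^sub>F n in sequentially. real n ^ 2 / 2 ^ n < 1 / K \<and> \<sigma>\<^sub>0 \<le> real n ^ 2"
      by (rule eventually_conj)
    then obtain m where m: "\<And>n. m \<le> n \<Longrightarrow> real n ^ 2 / 2 ^ n < 1 / K \<and> \<sigma>\<^sub>0 \<le> real n ^ 2"
      unfolding eventually_sequentially by blast
    \<comment> \<open>A sublinear index beyond \<open>m\<close>; it forces the last sublinear index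
      \<open>j\<close> before \<open>T\<close> to be large as well, so that
      \<open>K * (Suc j)^2 < 2 ^ Suc j\<close>.\<close>
    obtain l where l: "max m N\<^sub>0 \<le> l" "L l < real (l + 1)" using low by blast
    obtain T where T: "Suc l \<le> T" "1 * real (D + 1) ^ T \<le> L T" using unbdd by blast
    define Z where "Z = {n. n \<le> T \<and> L n < real (n + 1)}"
    have Z: "finite Z" "l \<in> Z" using l T by (auto simp: Z_def)
    define j where "j = Max Z"
    have j: "l \<le> j" "j \<in> Z" "\<And>n. j < n \<Longrightarrow> n \<le> T \<Longrightarrow> real (n + 1) \<le> L n"
      using Z Max_ge[OF Z(1)] Max_in[OF Z(1)] by (fastforce simp: j_def Z_def not_less[symmetric])+
    \<comment> \<open>Exponential size makes \<open>T\<close> itself superlinear, so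
      \<open>j < T\<close> and the window starting at \<open>Suc j\<close> is nonempty.\<close>
    have "real (T + 1) \<le> 2 ^ T"
      using less_exp[of T] by (metis Suc_eq_plus1 Suc_leI of_nat_le_iff of_nat_numeral of_nat_power)
    also have "\<dots> \<le> real (D + 1) ^ T" using D by (intro power_mono) auto
    finally have "T \<notin> Z" using T by (simp add: Z_def)
    with j(2) have jT: "Suc j \<le> T" by (metis Z_def le_neq_implies_less mem_Collect_eq Suc_leI)
    show ?thesis
    proof (rule main[of "Suc j" T "real (Suc j) ^ 2"])
      show "N\<^sub>0 \<le> Suc j" "Suc j \<le> T" using l j jT by auto
      have "(\<Sum>n<Suc j. L n) \<le> of_nat (card {..<Suc j}) * real (Suc j)"
      proof (rule sum_bounded_above)
        fix n assume "n \<in> {..<Suc j}"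
        then have "L n \<le> L j" by (intro monoD[OF mono]) auto
        also have "L j \<le> real (Suc j)" using j by (simp add: Z_def)
        finally show "L n \<le> real (Suc j)" .
      qed
      then show "(\<Sum>n<Suc j. L n) \<le> real (Suc j) ^ 2" by (simp only: card_lessThan power2_eq_square)
      have mj: "real (Suc j) ^ 2 / 2 ^ Suc j < 1 / K \<and> \<sigma>\<^sub>0 \<le> real (Suc j) ^ 2"
        using l j by (intro m) auto
      then show "\<sigma>\<^sub>0 \<le> real (Suc j) ^ 2" by blast
      have "K * real (Suc j) ^ 2 < 2 ^ Suc j"
      proof -
        have "real (Suc j) ^ 2 < 1 / K * 2 ^ Suc j"
          using mj by (subst (asm) pos_divide_less_eq) auto
        then show ?thesis using K by (simp add: field_simps del: power_Suc of_nat_Suc)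
      qed
      also have "(2::real) ^ Suc j \<le> real (D + 1) ^ Suc j" using D by (intro power_mono) auto
      finally have "K * real (Suc j) ^ 2 * real (D + 1) ^ (T - Suc j) \<le>
          real (D + 1) ^ Suc j * real (D + 1) ^ (T - Suc j)"
        by (intro mult_right_mono) auto
      also have "\<dots> = real (D + 1) ^ T" using jT by (simp only: le_add_diff_inverse flip: power_add)
      finally show "K * real (Suc j) ^ 2 * real (D + 1) ^ (T - Suc j) \<le> L T" using T(2) by simp
      show "real (n + 1) \<le> L n" if "Suc j \<le> n" "n \<le> T" for n using j that by auto
    qed
  qed
qed

section \<open>The Liouville argument for sorted denominators\<close>

text \<open>A monomial of degree \<open>i\<close> consumes \<open>q ^ i\<close>, and the spare
  factor \<open>q ^ (D - i)\<close> is integral.\<close>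

lemma int_poly_clear_denominator:
  fixes f :: "real poly"
  assumes "\<And>i. coeff f i \<in> \<int>" "q \<in> \<int>" "q * x \<in> \<int>" "degree f \<le> D"
  shows "q ^ D * poly f x \<in> \<int>"
proof -
  have "q ^ D * poly f x = (\<Sum>i\<le>degree f. coeff f i * (q * x) ^ i * q ^ (D - i))"
  proof -
    have "q ^ D * (coeff f i * x ^ i) = coeff f i * (q * x) ^ i * q ^ (D - i)" if "i \<le> degree f" for i
    proof -
      have "q ^ D = q ^ i * q ^ (D - i)" using that assms(4) by (simp flip: power_add)
      then show ?thesis by (simp add: power_mult_distrib)
    qed
    then show ?thesis unfolding poly_altdef sum_distrib_left by (intro sum.cong) auto
  qed
  also have "\<dots> \<in> \<int>"
    by (intro Ints_sum Ints_mult[OF Ints_mult] Ints_power assms)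
  finally show ?thesis .
qed

lemma Ints_prod_times_sum_div:
  fixes a b :: "nat \<Rightarrow> int"
  assumes "\<And>n. a n \<noteq> 0"
  shows "(\<Prod>n<N. real_of_int (a n)) * (\<Sum>n<N. real_of_int (b n) / real_of_int (a n)) \<in> \<int>"
proof (induction N)
  case (Suc N)
  let ?Q = "\<Prod>n<N. real_of_int (a n)" and ?S = "\<Sum>n<N. real_of_int (b n) / real_of_int (a n)"
  have "(\<Prod>n<Suc N. real_of_int (a n)) * (\<Sum>n<Suc N. real_of_int (b n) / real_of_int (a n)) =
      (?Q * ?S) * real_of_int (a N) + ?Q * real_of_int (b N)"
    using assms[of N] by (simp add: field_simps)
  also have "\<dots> \<in> \<int>"
    by (intro Ints_add Ints_mult[OF Suc] Ints_mult[OF Ints_prod] Ints_of_int)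
  finally show ?case .
qed simp

lemma log_growth:
  assumes "real (n + 1) powr (1 + \<epsilon>) \<le> x"
  shows "(1 + \<epsilon>) * log 2 (real (n + 1)) \<le> log 2 x"
proof -
  have "(1 + \<epsilon>) * log 2 (real (n + 1)) = log 2 (real (n + 1) powr (1 + \<epsilon>))"
    by (simp add: log_powr)
  also have "\<dots> \<le> log 2 x" using assms by (subst log_le_cancel_iff) (auto intro: less_le_trans[OF _ assms])
  finally show ?thesis .
qed

text \<open>The situation after the multipliers \<open>c\<close> have been absorbed and the terms
  sorted. Indices start at 0, hence \<open>n + 1\<close> in the growth condition.\<close>

locale slowly_perturbed_series =
  fixes a b :: "nat \<Rightarrow> int" and \<epsilon> \<kappa> :: real
  assumes eps: "0 < \<epsilon>" and kappa: "0 < \<kappa>" "\<kappa> < 1"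
    and a_mono: "mono a"
    and a_growth: "\<And>n. real (n + 1) powr (1 + \<epsilon>) \<le> real_of_int (a n)"
    and b_bound: "\<And>n. real_of_int \<bar>b n\<bar> \<le> 2 powr (log 2 (real_of_int (a n)) powr \<kappa>)"
begin

definition L :: "nat \<Rightarrow> real" where "L n = log 2 (real_of_int (a n))"

definition S :: "nat \<Rightarrow> real" where "S N = (\<Sum>n<N. real_of_int (b n) / real_of_int (a n))"

lemma a_pos: "0 < a n"
proof -
  have "0 < real (n + 1) powr (1 + \<epsilon>)" by simp
  also note a_growth[of n]
  finally show ?thesis by simp
qed

lemma powr_L: "2 powr L n = real_of_int (a n)"
  using a_pos[of n] by (simp add: L_def)

lemma L_growth: "(1 + \<epsilon>) * log 2 (real (n + 1)) \<le> L n"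
  unfolding L_def by (rule log_growth[OF a_growth])

lemma L_mono: "mono L"
proof
  fix m n :: nat assume "m \<le> n"
  then have "a m \<le> a n" by (rule monoD[OF a_mono])
  then show "L m \<le> L n" using a_pos[of m] a_pos[of n] by (simp add: L_def)
qed

lemma norm_term_le: "norm (real_of_int (b n) / real_of_int (a n)) \<le> 2 powr (L n powr \<kappa> - L n)"
proof -
  have "\<bar>real_of_int (b n)\<bar> / real_of_int (a n) \<le> 2 powr (L n powr \<kappa>) / real_of_int (a n)"
    using b_bound[of n] a_pos[of n] unfolding L_def by (intro divide_right_mono) auto
  then show ?thesis using a_pos[of n] by (simp add: powr_diff powr_L)
qed

lemma summable_weights_L: "summable (\<lambda>n. 2 powr (L n powr \<kappa> - L n))"
  by (rule summable_weights[OF eps kappa L_growth])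

lemma summable_norm_terms: "summable (\<lambda>n. norm (real_of_int (b n) / real_of_int (a n)))"
  by (rule summable_comparison_test'[OF summable_weights_L, of 0]) (use norm_term_le in auto)

text \<open>If the sum \<alpha> were a root, \<open>Q ^ D * poly f (S N)\<close> would be a nonzero
  integer for late \<open>N\<close>; but it is \<open>Q ^ D * (S N - \<alpha>)\<close> times a
  bounded cofactor, and a good cut makes this less than 1 in absolute value.\<close>

lemma not_root_of_int_poly:
  fixes f :: "real poly"
  assumes unbdd: "\<And>M m. \<exists>n\<ge>m. M * real (D + 1) ^ n \<le> L n"
    and avoid: "\<And>q. \<forall>\<^sub>F N in sequentially. S N \<noteq> q"
    and f: "\<And>i. coeff f i \<in> \<int>" "f \<noteq> 0" "degree f \<le> D" and D: "1 \<le> D"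
  shows "poly f (\<Sum>n. real_of_int (b n) / real_of_int (a n)) \<noteq> 0"
proof
  define \<alpha> where "\<alpha> = (\<Sum>n. real_of_int (b n) / real_of_int (a n))"
  assume "poly f (\<Sum>n. real_of_int (b n) / real_of_int (a n)) = 0"
  then have "[:- \<alpha>, 1:] dvd f" unfolding \<alpha>_def[symmetric] poly_eq_0_iff_dvd .
  then obtain g where g: "f = [:- \<alpha>, 1:] * g" by (elim dvdE)
  define w where "w n = 2 powr (L n powr \<kappa> - L n)" for n
  have sm: "summable (\<lambda>n. real_of_int (b n) / real_of_int (a n))"
    using summable_norm_cancel[OF summable_norm_terms] .
  have "S \<longlonglongrightarrow> \<alpha>"
    using summable_LIMSEQ[OF sm] unfolding S_def[abs_def] \<alpha>_def .
  then have "(\<lambda>N. poly g (S N)) \<longlonglongrightarrow> poly g \<alpha>" by (intro tendsto_intros)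
  then have "Bseq (\<lambda>N. poly g (S N))" by (intro convergent_imp_Bseq convergentI)
  then obtain G where G: "0 < G" "\<And>N. \<bar>poly g (S N)\<bar> \<le> G" by (auto elim: BseqE)
  \<comment> \<open>A nonzero polynomial has finitely many roots, so avoiding each one eventually
    means avoiding all of them eventually.\<close>
  have "\<forall>\<^sub>F N in sequentially. \<forall>q\<in>{x. poly f x = 0}. S N \<noteq> q"
    using avoid poly_roots_finite[OF f(2)] by (intro eventually_ball_finite) auto
  then obtain N\<^sub>0 where N0: "\<And>N. N\<^sub>0 \<le> N \<Longrightarrow> poly f (S N) \<noteq> 0"
    unfolding eventually_sequentially by blast
  obtain N where N: "N\<^sub>0 \<le> N" "2 powr (real D * (\<Sum>n<N. L n)) * (\<Sum>n. w (n + N)) < 1 / G"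
    using exists_good_cut[OF eps kappa D, of "1 / G" L N\<^sub>0] L_mono L_growth unbdd G unfolding w_def by auto
  define Q where "Q = (\<Prod>n<N. real_of_int (a n))"
  have Q0: "0 < Q" unfolding Q_def using a_pos by (intro prod_pos) auto
  have Q: "2 powr (real D * (\<Sum>n<N. L n)) = Q ^ D"
  proof -
    have "Q = 2 powr (\<Sum>n<N. L n)" by (simp add: Q_def powr_sum powr_L flip: powr_L)
    then show ?thesis by (simp add: powr_powr mult.commute flip: powr_realpow)
  qed
  have tail: "\<bar>S N - \<alpha>\<bar> \<le> (\<Sum>n. w (n + N))"
  proof -
    have "\<alpha> - S N = (\<Sum>n. real_of_int (b (n + N)) / real_of_int (a (n + N)))"
      unfolding \<alpha>_def S_def using suminf_split_initial_segment[OF sm, of N] by simp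
    also have "norm \<dots> \<le> (\<Sum>n. w (n + N))"
    proof (rule norm_suminf_le)
      show "norm (real_of_int (b (n + N)) / real_of_int (a (n + N))) \<le> w (n + N)" for n
        unfolding w_def by (rule norm_term_le)
      show "summable (\<lambda>n. w (n + N))"
        unfolding w_def using summable_ignore_initial_segment[OF summable_weights_L] .
    qed
    finally show ?thesis by simp
  qed
  have "Q ^ D * poly f (S N) \<in> \<int>"
  proof (rule int_poly_clear_denominator[OF f(1) _ _ f(3)])
    show "Q \<in> \<int>" unfolding Q_def by (intro Ints_prod) auto
    show "Q * S N \<in> \<int>" unfolding Q_def S_def using a_pos
      by (intro Ints_prod_times_sum_div) (metis less_irrefl)
  qed
  moreover have "Q ^ D * poly f (S N) \<noteq> 0" using N0[OF N(1)] Q0 by simp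
  ultimately have "1 \<le> \<bar>Q ^ D * poly f (S N)\<bar>" by (rule Ints_nonzero_abs_ge1)
  also have "\<dots> = Q ^ D * (\<bar>S N - \<alpha>\<bar> * \<bar>poly g (S N)\<bar>)" 
  proof -
    have "poly f (S N) = (S N - \<alpha>) * poly g (S N)" by (simp add: g algebra_simps)
    then show ?thesis using Q0 by (simp add: abs_mult)
  qed
  also have "\<dots> \<le> Q ^ D * ((\<Sum>n. w (n + N)) * G)"
    using Q0 tail G by (intro mult_left_mono mult_mono) (auto intro: order.trans[OF abs_ge_zero])
  also have "\<dots> = (Q ^ D * (\<Sum>n. w (n + N))) * G" by simp
  also have "\<dots> < 1 / G * G" using N(2) G unfolding Q by (intro mult_strict_right_mono) auto
  finally show False using G by simp
qed

end

section \<open>Rearrangement in increasing order\<close>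

lemma sorting_permutation:
  fixes f :: "nat \<Rightarrow> 'a :: linorder"
  assumes fin: "\<And>n. finite {m. f m \<le> f n}"
  obtains \<pi> :: "nat \<Rightarrow> nat" where "bij \<pi>" "mono (\<lambda>n. f (\<pi> n))"
proof -
  \<comment> \<open>Ties are broken by the index, which makes this a strict total order and the rank
    \<open>e\<close> injective.\<close>
  define below where "below n = {m. f m < f n \<or> f m = f n \<and> m < n}" for n
  define e where "e n = card (below n)" for n
  have fin_below: "finite (below n)" for n
    by (rule finite_subset[OF _ fin[of n]]) (auto simp: below_def)
  have less: "e m < e n" if "m \<in> below n" for m n
    unfolding e_def
  proof (intro psubset_card_mono fin_below psubsetI)
    show "below m \<subseteq> below n" using that by (auto simp: below_def)
    show "below m \<noteq> below n" using that by (auto simp: below_def)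
  qed
  have total: "m = n \<or> m \<in> below n \<or> n \<in> below m" for m n by (auto simp: below_def)
  have inj: "inj e"
  proof (rule injI)
    fix m n assume "e m = e n"
    then have "m \<notin> below n" "n \<notin> below m" using less[of m n] less[of n m] by auto
    then show "m = n" using total by blast
  qed
  have inf: "infinite (range e)" using inj by (simp add: finite_image_iff)
  \<comment> \<open>Enumerating the range of the ranks in increasing order gives the sorted order
    directly, whether or not every natural number is a rank.\<close>
  define \<pi> where "\<pi> n = inv e (enumerate (range e) n)" for n
  have e_pi: "e (\<pi> n) = enumerate (range e) n" for n
    unfolding \<pi>_def using enumerate_in_set[OF inf] by (rule f_inv_into_f)
  show thesis
  proof (rule that[of \<pi>])
    show "bij \<pi>"
    proof (rule bijI)
      show "inj \<pi>"
      proof (rule injI)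
        fix m n assume "\<pi> m = \<pi> n"
        then have "enumerate (range e) m = enumerate (range e) n" by (metis e_pi)
        then show "m = n" using inf by (metis enumerate_mono less_irrefl linorder_neqE_nat)
      qed
      have "\<exists>m. n = \<pi> m" for n
      proof -
        obtain m where "enumerate (range e) m = e n" using enumerate_Ex[OF inf rangeI[of e n]] by blast
        then have "e (\<pi> m) = e n" by (simp only: e_pi)
        then show ?thesis using injD[OF inj] by metis
      qed
      then show "surj \<pi>" by (simp add: surj_def)
    qed
    show "mono (\<lambda>n. f (\<pi> n))"
    proof (rule monoI)
      fix m n :: nat assume "m \<le> n"
      then have "e (\<pi> m) \<le> e (\<pi> n)" using inf unfolding e_pi by (metis enumerate_mono le_less)
      then have "\<pi> n \<notin> below (\<pi> m)" using less by (metis not_less)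
      then show "f (\<pi> m) \<le> f (\<pi> n)" by (auto simp: below_def not_less)
    qed
  qed
qed

text \<open>Pigeonhole: among the \<open>n + 1\<close> distinct values \<pi> 0, ..., \<pi> n, one is
  at least \<open>n\<close>, and sortedness carries its bound over to position
  \<open>n\<close>.\<close>

lemma sorted_ge_mono_minorant:
  fixes f g :: "nat \<Rightarrow> 'a :: linorder"
  assumes "inj \<pi>" "mono (\<lambda>n. f (\<pi> n))" "mono g" "\<And>n. g n \<le> f n"
  shows "g n \<le> f (\<pi> n)"
proof -
  have "\<not> \<pi> ` {..n} \<subseteq> {..<n}"
  proof
    assume "\<pi> ` {..n} \<subseteq> {..<n}"
    then have "card (\<pi> ` {..n}) \<le> card {..<n}" by (intro card_mono) auto
    moreover have "card (\<pi> ` {..n}) = card {..n}"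
      using assms(1) by (intro card_image) (auto intro: inj_on_subset)
    ultimately show False by simp
  qed
  then obtain i where i: "i \<le> n" "n \<le> \<pi> i" by (meson atMost_iff image_subsetI lessThan_iff not_less)
  have "g n \<le> g (\<pi> i)" by (rule monoD[OF assms(3) i(2)])
  also have "\<dots> \<le> f (\<pi> i)" by (rule assms(4))
  also have "\<dots> \<le> f (\<pi> n)" using monoD[OF assms(2) i(1)] .
  finally show ?thesis .
qed

section \<open>Denominators of finite sums at a prime\<close>

text \<open>Expresses in integers that the sum has p-adic valuation at least \<open>- e\<close>: the
  factor \<open>u\<close> collects the parts of the denominators that are prime to
  \<open>p\<close>.\<close>

lemma sum_fractions_clear_prime_power:
  fixes a b :: "nat \<Rightarrow> int" and p :: int
  assumes p: "prime p" and I: "finite I"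
    and a: "\<And>n. n \<in> I \<Longrightarrow> a n \<noteq> 0" "\<And>n. n \<in> I \<Longrightarrow> multiplicity p (a n) \<le> e"
  shows "\<exists>u z. \<not> p dvd u \<and>
    real_of_int u * real_of_int p ^ e * (\<Sum>n\<in>I. real_of_int (b n) / real_of_int (a n)) = real_of_int z"
  using I a
proof (induction I rule: finite_induct)
  case empty
  show ?case using p by (intro exI[of _ 1] exI[of _ 0]) (auto simp: not_prime_unit)
next
  case (insert m I)
  then obtain u z where uz: "\<not> p dvd u"
      "real_of_int u * real_of_int p ^ e * (\<Sum>n\<in>I. real_of_int (b n) / real_of_int (a n)) = real_of_int z"
    by auto
  define v where "v = multiplicity p (a m)"
  have "a m \<noteq> 0" "\<not> is_unit p" using insert p by (auto simp: not_prime_unit)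
  then obtain t where t: "a m = p ^ v * t" "\<not> p dvd t"
    unfolding v_def by (rule multiplicity_decompose')
  have v: "v \<le> e" using insert by (auto simp: v_def)
  have p0: "real_of_int p \<noteq> 0" using p by auto
  have t0: "real_of_int t \<noteq> 0" using t(2) by auto
  have pe: "real_of_int p ^ e = real_of_int p ^ v * real_of_int p ^ (e - v)"
    using v by (simp flip: power_add)
  have "real_of_int (t * u) * real_of_int p ^ e * (\<Sum>n\<in>insert m I. real_of_int (b n) / real_of_int (a n)) =
      real_of_int t * (real_of_int u * real_of_int p ^ e * (\<Sum>n\<in>I. real_of_int (b n) / real_of_int (a n)))
      + real_of_int (t * u) * real_of_int p ^ e * (real_of_int (b m) / real_of_int (a m))"
    using insert(1,2) by (simp add: algebra_simps)
  also have "real_of_int (t * u) * real_of_int p ^ e * (real_of_int (b m) / real_of_int (a m)) =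
      real_of_int (u * p ^ (e - v) * b m)"
    using p0 t0 unfolding t(1) pe by (simp add: field_simps)
  finally have "real_of_int (t * u) * real_of_int p ^ e * (\<Sum>n\<in>insert m I. real_of_int (b n) / real_of_int (a n)) =
      real_of_int (t * z + u * p ^ (e - v) * b m)" unfolding uz(2) by simp
  moreover have "\<not> p dvd t * u" using t(2) uz(1) p by (simp add: prime_dvd_mult_iff)
  ultimately show ?case by blast
qed

text \<open>The term at \<open>m\<close> has strictly the most negative p-adic valuation, so nothing
  cancels it and \<open>p\<close> survives in the denominator of any fraction equal to the
  sum.\<close>

lemma prime_dvd_denominator_of_sum:
  fixes a b :: "nat \<Rightarrow> int" and p r s :: int
  assumes p: "prime p" and I: "finite I" "m \<in> I" and a: "\<And>n. n \<in> I \<Longrightarrow> a n \<noteq> 0"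
    and dom: "\<And>n. n \<in> I \<Longrightarrow> n \<noteq> m \<Longrightarrow> multiplicity p (a n) < multiplicity p (a m)"
    and pos: "p dvd a m" and b: "\<not> p dvd b m"
    and s: "s \<noteq> 0" and eq: "(\<Sum>n\<in>I. real_of_int (b n) / real_of_int (a n)) = real_of_int r / real_of_int s"
  shows "p dvd s"
proof -
  \<comment> \<open>The bound for all the other terms; \<open>pos\<close> rules out truncation of
    the subtraction.\<close>
  define e where "e = multiplicity p (a m) - 1"
  have "0 < multiplicity p (a m)"
    using p a[OF I(2)] pos by (subst prime_multiplicity_gt_zero_iff) (auto simp: prime_imp_prime_elem)
  then have v: "multiplicity p (a m) = Suc e" by (simp add: e_def)
  obtain u z where uz: "\<not> p dvd u" "real_of_int u * real_of_int p ^ e *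
      (\<Sum>n\<in>I - {m}. real_of_int (b n) / real_of_int (a n)) = real_of_int z"
  proof -
    have "\<exists>u z. \<not> p dvd u \<and> real_of_int u * real_of_int p ^ e *
      (\<Sum>n\<in>I - {m}. real_of_int (b n) / real_of_int (a n)) = real_of_int z"
    proof (rule sum_fractions_clear_prime_power[OF p])
      show "multiplicity p (a n) \<le> e" if "n \<in> I - {m}" for n
        using dom[of n] that v by simp
    qed (use I a in auto)
    then show thesis using that by blast
  qed
  have "a m \<noteq> 0" "\<not> is_unit p" using I a p by (auto simp: not_prime_unit)
  then obtain t where t: "a m = p ^ Suc e * t" "\<not> p dvd t"
    unfolding v[symmetric] by (rule multiplicity_decompose')
  have p0: "real_of_int p \<noteq> 0" using p by auto
  have t0: "real_of_int t \<noteq> 0" using t(2) by auto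
  have s0: "real_of_int s \<noteq> 0" using s by simp
  have split: "real_of_int r / real_of_int s = real_of_int (b m) / real_of_int (a m) +
      (\<Sum>n\<in>I - {m}. real_of_int (b n) / real_of_int (a n))"
    unfolding eq[symmetric] using I by (rule sum.remove)
  \<comment> \<open>Clearing denominators with \<open>s * p ^ Suc e * t * u\<close> leaves
    \<open>s * u * b m\<close> as the only term without a visible factor \<open>p\<close>.\<close>
  have "real_of_int (p * (u * p ^ e * t * r)) =
      real_of_int s * (real_of_int p * real_of_int t) * (real_of_int u * real_of_int p ^ e * (real_of_int r / real_of_int s))"
    using s0 by simp
  also have "\<dots> = real_of_int s * (real_of_int p * real_of_int t) *
      (real_of_int u * real_of_int p ^ e * (real_of_int (b m) / real_of_int (a m)) + real_of_int z)"
    unfolding split uz(2)[symmetric] by (simp add: algebra_simps)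
  also have "\<dots> = real_of_int (s * u * b m + p * (s * t * z))"
    using p0 t0 unfolding t(1) by (simp add: field_simps)
  finally have "p * (u * p ^ e * t * r) = s * u * b m + p * (s * t * z)" by (simp only: of_int_eq_iff)
  then have "s * u * b m = p * (u * p ^ e * t * r - s * t * z)" by (simp add: algebra_simps)
  then have "p dvd s * u * b m" by simp
  then show ?thesis using uz(1) b p by (simp add: prime_dvd_mult_iff)
qed

section \<open>Application to the series with multipliers \<open>c\<close>\<close>

lemma limsup_root_infinite_imp_log_unbounded:
  fixes x :: "nat \<Rightarrow> real" and B M :: real
  assumes lim: "limsup (\<lambda>n. ereal (x n powr (1 / B ^ n))) = \<infinity>" and B: "0 < B"
    and x: "\<And>n. 1 \<le> n \<Longrightarrow> 0 < x n"
  shows "\<exists>n\<ge>m. M * B ^ n \<le> log 2 (x n)"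
proof (rule ccontr)
  assume neg: "\<not> ?thesis"
  \<comment> \<open>The value at index 0 is arbitrary, hence \<open>max m 1\<close>.\<close>
  have "x n powr (1 / B ^ n) \<le> 2 powr M" if n: "max m 1 \<le> n" for n
  proof -
    have "log 2 (x n) < M * B ^ n" using neg n by (meson max.boundedE not_le)
    then have "log 2 (x n) / B ^ n \<le> M" using B by (simp add: pos_divide_le_eq)
    moreover have "x n powr (1 / B ^ n) = 2 powr (log 2 (x n) / B ^ n)"
    proof -
      have "x n powr (1 / B ^ n) = (2 powr log 2 (x n)) powr (1 / B ^ n)" using x[of n] n by simp
      then show ?thesis by (simp add: powr_powr)
    qed
    ultimately show ?thesis by simp
  qed
  then have "\<forall>\<^sub>F n in sequentially. ereal (x n powr (1 / B ^ n)) \<le> ereal (2 powr M)"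
    unfolding eventually_sequentially ereal_less_eq by blast
  then have "limsup (\<lambda>n. ereal (x n powr (1 / B ^ n))) \<le> ereal (2 powr M)" by (rule Limsup_bounded)
  with lim show False by simp
qed

context
  fixes P :: "nat set" and \<epsilon> \<kappa> :: real and a b c :: "nat \<Rightarrow> int"
  assumes P_inf: "infinite P" and P_prime: "\<forall>p\<in>P. prime p"
    and eps: "\<epsilon> > 0" and kappa: "\<kappa> > 0" "\<kappa> < 1"
    and gcd_cond: "\<forall>p\<in>P. \<forall>n\<ge>1. \<not> int p dvd gcd (a n) (b n)"
    and val_bdd: "\<forall>p\<in>P. bdd_above {multiplicity (int p) (a n) | n. n \<ge> 1}"
    and val_max: "\<forall>p\<in>P. \<exists>!m. m \<ge> 1 \<and>
        multiplicity (int p) (a m) = Sup {multiplicity (int p) (a n) | n. n \<ge> 1}"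
    and a_mono: "\<forall>n\<ge>1. a n \<le> a (Suc n)"
    and a_growth: "\<forall>n\<ge>1. real_of_int (a n) \<ge> real n powr (1 + \<epsilon>)"
    and b_bound: "\<forall>n\<ge>1. real_of_int \<bar>b n\<bar> \<le> 2 powr ((log 2 \<bar>real_of_int (a n)\<bar>) powr \<kappa>)"
    and c_ndvd: "\<forall>n\<ge>1. \<forall>p\<in>P. \<not> int p dvd c n"
begin

text \<open>Only the absolute value of \<open>c\<close> goes into the denominator, which thus stays
  positive and can be sorted; the sign goes into \<open>num\<close>. The shift by \<open>Suc\<close>
  passes from indices starting at 1 to indices starting at 0.\<close>

definition den :: "nat \<Rightarrow> int" where "den n = a (Suc n) * \<bar>c (Suc n)\<bar>"

definition num :: "nat \<Rightarrow> int" where "num n = b (Suc n) * sgn (c (Suc n))"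

lemma c_nz: "c (Suc n) \<noteq> 0"
proof -
  obtain p where "p \<in> P" using P_inf by (metis finite.emptyI ex_in_conv)
  then have "\<not> int p dvd c (Suc n)" using c_ndvd by auto
  then show ?thesis by auto
qed

lemma a_Suc_pos: "0 < a (Suc n)"
proof -
  have "0 < real (Suc n) powr (1 + \<epsilon>)" by simp
  also have "\<dots> \<le> real_of_int (a (Suc n))" using a_growth by auto
  finally show ?thesis by simp
qed

lemma a_le_den: "a (Suc n) \<le> den n"
  using mult_left_mono[of 1 "\<bar>c (Suc n)\<bar>" "a (Suc n)"] a_Suc_pos[of n] c_nz[of n] by (simp add: den_def)

lemma finite_den_le: "finite {m. den m \<le> den n}"
proof (rule finite_subset)
  show "{m. den m \<le> den n} \<subseteq> {..nat (den n)}"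
  proof
    fix m assume "m \<in> {m. den m \<le> den n}"
    have "real (Suc m) powr 1 \<le> real (Suc m) powr (1 + \<epsilon>)" using eps by (intro powr_mono) auto
    also have "\<dots> \<le> real_of_int (a (Suc m))" using a_growth by auto
    finally have "int (Suc m) \<le> a (Suc m)" by simp
    also have "\<dots> \<le> den m" by (rule a_le_den)
    also have "\<dots> \<le> den n" using \<open>m \<in> _\<close> by simp
    finally show "m \<in> {..nat (den n)}" by simp
  qed
qed simp

lemma term_eq: "1 / (real_of_int (a (Suc n)) / real_of_int (b (Suc n)) * real_of_int (c (Suc n))) =
    real_of_int (num n) / real_of_int (den n)"
proof -
  have "real_of_int (c (Suc n)) = real_of_int (sgn (c (Suc n))) * real_of_int \<bar>c (Suc n)\<bar>"
    unfolding of_int_mult[symmetric] sgn_mult_abs ..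
  moreover have "sgn (c (Suc n)) = 1 \<or> sgn (c (Suc n)) = - 1" using c_nz[of n] by (auto simp: sgn_if)
  ultimately show ?thesis by (auto simp: den_def num_def)
qed

text \<open>For a rational value with denominator \<open>s\<close>, take \<open>p\<close> in
  \<open>P\<close> larger than \<open>s\<close>. Once the partial sum contains the unique index of
  maximal valuation at \<open>p\<close>, equality would force \<open>p\<close> to divide
  \<open>s\<close>. Irrational values are never attained.\<close>

lemma eventually_partial_sum_neq:
  assumes bij: "bij \<pi>"
  shows "\<forall>\<^sub>F N in sequentially. (\<Sum>n<N. real_of_int (num (\<pi> n)) / real_of_int (den (\<pi> n))) \<noteq> q"
proof (cases "q \<in> \<rat>")
  case False
  have "(\<Sum>n<N. real_of_int (num (\<pi> n)) / real_of_int (den (\<pi> n))) \<in> \<rat>" for N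
    by (intro Rats_sum Rats_divide) auto
  with False show ?thesis by (intro always_eventually) metis
next
  case True
  then obtain r s where q: "q = real_of_int r / real_of_int s" and s: "0 < s"
    by (auto elim!: Rats_cases')
  obtain p where p: "p \<in> P" "nat s < p" using P_inf unfolding infinite_nat_iff_unbounded by blast
  have prime: "prime (int p)" using P_prime p by auto
  let ?V = "{multiplicity (int p) (a n) | n. n \<ge> 1}"
  obtain m where m: "m \<ge> 1" "multiplicity (int p) (a m) = Sup ?V"
    and uniq: "\<And>n. n \<ge> 1 \<Longrightarrow> multiplicity (int p) (a n) = Sup ?V \<Longrightarrow> n = m"
    using val_max p(1) by (metis (no_types, lifting))
  have less: "multiplicity (int p) (a n) < multiplicity (int p) (a m)" if "n \<ge> 1" "n \<noteq> m" for n
  proof -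
    have "multiplicity (int p) (a n) \<le> Sup ?V"
      using val_bdd p(1) that by (intro cSup_upper) auto
    then show ?thesis using uniq[of n] that m(2) by fastforce
  qed
  \<comment> \<open>The maximum is positive, since the index \<open>Suc m\<close> has a strictly
    smaller valuation.\<close>
  have dvd: "int p dvd a m"
    using less[of "Suc m"] m(1) not_dvd_imp_multiplicity_0[of "int p" "a m"] by fastforce
  have mult_den: "multiplicity (int p) (den n) = multiplicity (int p) (a (Suc n))" for n
  proof -
    have "multiplicity (int p) \<bar>c (Suc n)\<bar> = 0"
      using c_ndvd p(1) by (intro not_dvd_imp_multiplicity_0) auto
    then show ?thesis unfolding den_def using prime a_Suc_pos[of n] c_nz[of n]
      by (subst prime_elem_multiplicity_mult_distrib) auto
  qed
  obtain i where i: "Suc (\<pi> i) = m" using bij m(1) by (metis Suc_le_D One_nat_def bij_pointE)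
  \<comment> \<open>Since \<open>p\<close> divides \<open>a m\<close>, the gcd condition keeps it
    from dividing \<open>b m\<close>.\<close>
  have ndvd: "\<not> int p dvd num (\<pi> i)"
  proof
    assume "int p dvd num (\<pi> i)"
    then have "int p dvd num (\<pi> i) * sgn (c m)" by simp
    also have "num (\<pi> i) * sgn (c m) = b m"
      using c_nz[of "\<pi> i"] unfolding num_def i by (simp add: sgn_if)
    finally show False using gcd_cond p(1) m(1) dvd by auto
  qed
  have "(\<Sum>n<N. real_of_int (num (\<pi> n)) / real_of_int (den (\<pi> n))) \<noteq> q" if N: "Suc i \<le> N" for N
  proof
    assume eq: "(\<Sum>n<N. real_of_int (num (\<pi> n)) / real_of_int (den (\<pi> n))) = q"
    have "int p dvd s"
    proof (rule prime_dvd_denominator_of_sum[OF prime, of "{..<N}" i "\<lambda>n. den (\<pi> n)" "\<lambda>n. num (\<pi> n)"])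
      show "den (\<pi> n) \<noteq> 0" for n using a_le_den[of "\<pi> n"] a_Suc_pos[of "\<pi> n"] by linarith
      show "multiplicity (int p) (den (\<pi> n)) < multiplicity (int p) (den (\<pi> i))" if "n \<noteq> i" for n
      proof -
        have "\<pi> n \<noteq> \<pi> i" using that bij by (metis bij_is_inj injD)
        then show ?thesis using less[of "Suc (\<pi> n)"] i unfolding mult_den by auto
      qed
      show "int p dvd den (\<pi> i)" using dvd by (simp add: den_def i)
    qed (use N ndvd s eq q in auto)
    then have "int p \<le> s" using s by (rule zdvd_imp_le)
    then show False using p(2) by simp
  qed
  then show ?thesis unfolding eventually_sequentially by blast
qed

text \<open>Both conclusions rest on the same sorted rearrangement. Irrationality will be the case
  \<open>D = 1\<close>; transcendence uses all degrees.\<close>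

lemma perturbed_series_not_root:
  shows "summable (\<lambda>n. 1 / (real_of_int (a (Suc n)) / real_of_int (b (Suc n)) * real_of_int (c (Suc n))))"
    and "\<lbrakk>\<And>M m. \<exists>n\<ge>m. M * real (D + 1) ^ n \<le> log 2 (real_of_int (a n)); 1 \<le> D;
        \<And>i. coeff f i \<in> \<int>; f \<noteq> 0; degree f \<le> D\<rbrakk> \<Longrightarrow>
      poly f (\<Sum>n. 1 / (real_of_int (a (Suc n)) / real_of_int (b (Suc n)) * real_of_int (c (Suc n)))) \<noteq> 0"
proof -
  obtain \<pi> :: "nat \<Rightarrow> nat" where bij: "bij \<pi>" and mono: "mono (\<lambda>n. den (\<pi> n))"
    by (rule sorting_permutation[OF finite_den_le])
  have mono_a: "mono (\<lambda>n. a (Suc n))" using a_mono by (intro incseq_SucI) auto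
  have a_le: "a (Suc n) \<le> den (\<pi> n)" for n
    using sorted_ge_mono_minorant[OF bij_is_inj[OF bij] mono mono_a a_le_den] .
  interpret slowly_perturbed_series "\<lambda>n. den (\<pi> n)" "\<lambda>n. num (\<pi> n)" \<epsilon> \<kappa>
  proof
    fix n
    have "real (Suc n) powr (1 + \<epsilon>) \<le> real_of_int (a (Suc n))" using a_growth by auto
    also have "\<dots> \<le> real_of_int (den (\<pi> n))" using a_le by simp
    finally show "real (n + 1) powr (1 + \<epsilon>) \<le> real_of_int (den (\<pi> n))" by simp
    let ?k = "Suc (\<pi> n)"
    have a1: "1 \<le> a ?k" using a_Suc_pos[of "\<pi> n"] by simp
    have "\<bar>num (\<pi> n)\<bar> = \<bar>b ?k\<bar>" using c_nz[of "\<pi> n"] by (simp add: num_def sgn_if)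
    then have "real_of_int \<bar>num (\<pi> n)\<bar> \<le> 2 powr (log 2 (real_of_int (a ?k)) powr \<kappa>)"
      using b_bound a1 by (metis One_nat_def Suc_le_mono abs_of_pos le0 of_int_0_less_iff a_Suc_pos)
    \<comment> \<open>The bound on \<open>b\<close> refers to \<open>a\<close> at the original index
      \<open>Suc (\<pi> n)\<close>, so it passes to the larger denominator of the same term.\<close>
    also have "\<dots> \<le> 2 powr (log 2 (real_of_int (den (\<pi> n))) powr \<kappa>)"
    proof -
      have "log 2 (real_of_int (a ?k)) \<le> log 2 (real_of_int (den (\<pi> n)))"
        using a1 a_le_den[of "\<pi> n"] by simp
      then show ?thesis using a1 kappa by (simp add: powr_mono2)
    qed
    finally show "real_of_int \<bar>num (\<pi> n)\<bar> \<le> 2 powr (log 2 (real_of_int (den (\<pi> n))) powr \<kappa>)" .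
  qed (use eps kappa mono in auto)
  define \<alpha> where "\<alpha> = (\<Sum>n. real_of_int (num (\<pi> n)) / real_of_int (den (\<pi> n)))"
  have "(\<lambda>n. real_of_int (num (\<pi> n)) / real_of_int (den (\<pi> n))) sums \<alpha>"
    unfolding \<alpha>_def by (rule summable_sums[OF summable_norm_cancel[OF summable_norm_terms]])
  \<comment> \<open>Absolute convergence gives an unconditional sum, which is invariant under \<pi>;
    the original series therefore has the same value.\<close>
  then have "((\<lambda>n. real_of_int (num (\<pi> n)) / real_of_int (den (\<pi> n))) has_sum \<alpha>) UNIV"
    by (rule norm_summable_imp_has_sum[OF summable_norm_terms])
  then have "((\<lambda>n. real_of_int (num n) / real_of_int (den n)) has_sum \<alpha>) UNIV"
    using has_sum_reindex_bij_betw[of \<pi> UNIV UNIV "\<lambda>n. real_of_int (num n) / real_of_int (den n)"] bij by simp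
  then have sums: "(\<lambda>n. 1 / (real_of_int (a (Suc n)) / real_of_int (b (Suc n)) * real_of_int (c (Suc n)))) sums \<alpha>"
    unfolding term_eq by (rule has_sum_imp_sums)
  then show "summable (\<lambda>n. 1 / (real_of_int (a (Suc n)) / real_of_int (b (Suc n)) * real_of_int (c (Suc n))))"
    by (rule sums_summable)
  assume unbdd: "\<And>M m. \<exists>n\<ge>m. M * real (D + 1) ^ n \<le> log 2 (real_of_int (a n))" and D: "1 \<le> D"
    and f: "\<And>i. coeff f i \<in> \<int>" "f \<noteq> 0" "degree f \<le> D"
  have "\<exists>n\<ge>m. M * real (D + 1) ^ n \<le> L n" for M m
  proof -
    \<comment> \<open>The shift from \<open>k = Suc n\<close> to \<open>n\<close> lowers the power
      of \<open>D + 1\<close>; the absolute value of \<open>M\<close> keeps the inequality valid for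
      negative \<open>M\<close>.\<close>
    obtain k where k: "Suc m \<le> k" "\<bar>M\<bar> * real (D + 1) ^ k \<le> log 2 (real_of_int (a k))"
      using unbdd by blast
    then obtain n where n: "k = Suc n" "m \<le> n" by (metis Suc_le_D Suc_le_mono)
    have "M * real (D + 1) ^ n \<le> \<bar>M\<bar> * real (D + 1) ^ k"
      unfolding n(1) by (intro mult_mono power_increasing) auto
    also note k(2)
    also have "log 2 (real_of_int (a k)) \<le> L n"
      unfolding n(1) L_def using a_Suc_pos[of n] a_le[of n] by simp
    finally show ?thesis using n(2) by blast
  qed
  then have "poly f \<alpha> \<noteq> 0" unfolding \<alpha>_def
    using eventually_partial_sum_neq[OF bij] f D by (intro not_root_of_int_poly) (auto simp: S_def)
  then show "poly f (\<Sum>n. 1 / (real_of_int (a (Suc n)) / real_of_int (b (Suc n)) * real_of_int (c (Suc n)))) \<noteq> 0"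
    using sums_unique[OF sums] by simp
qed

end

section \<open>The irrationality and transcendence criteria\<close>

theorem theorem8:
  fixes P :: "nat set" and \<epsilon> \<kappa> :: real and a b :: "nat \<Rightarrow> int"
  assumes P_inf: "infinite P" and P_prime: "\<forall>p\<in>P. prime p"
    and eps: "\<epsilon> > 0" and kappa: "\<kappa> > 0" "\<kappa> < 1"
    and a_nz: "\<forall>n\<ge>1. a n \<noteq> 0" and b_nz: "\<forall>n\<ge>1. b n \<noteq> 0"
    and gcd_cond: "\<forall>p\<in>P. \<forall>n\<ge>1. \<not> int p dvd gcd (a n) (b n)"
    and val_bdd: "\<forall>p\<in>P. bdd_above {multiplicity (int p) (a n) | n. n \<ge> 1}"
    and val_max: "\<forall>p\<in>P. \<exists>!m. m \<ge> 1 \<and>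
        multiplicity (int p) (a m) = Sup {multiplicity (int p) (a n) | n. n \<ge> 1}"
    and a_mono: "\<forall>n\<ge>1. a n \<le> a (Suc n)"
    and a_growth: "\<forall>n\<ge>1. real_of_int (a n) \<ge> real n powr (1 + \<epsilon>)"
    and b_bound: "\<forall>n\<ge>1. real_of_int \<bar>b n\<bar> \<le> 2 powr ((log 2 \<bar>real_of_int (a n)\<bar>) powr \<kappa>)"
  shows "(limsup (\<lambda>n. ereal (\<bar>real_of_int (a n)\<bar> powr (1 / 2 ^ n))) = \<infinity> \<longrightarrow>
            P_irrational P (\<lambda>n. real_of_int (a n) / real_of_int (b n)))
       \<and> ((\<forall>A::nat. A > 0 \<longrightarrow>
              limsup (\<lambda>n. ereal (real_of_int (a n) powr (1 / real A ^ n))) = \<infinity>) \<longrightarrow>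
            P_transcendental P (\<lambda>n. real_of_int (a n) / real_of_int (b n)))"
proof (intro conjI impI)
  have a_pos: "0 < real_of_int (a n)" if "1 \<le> n" for n
  proof -
    have "0 < real n powr (1 + \<epsilon>)" using that by simp
    also have "\<dots> \<le> real_of_int (a n)" using a_growth that by auto
    finally show ?thesis .
  qed
  have quot_nz: "real_of_int (a n) / real_of_int (b n) \<noteq> 0" if "1 \<le> n" for n
    using a_nz b_nz that by simp
  note series = perturbed_series_not_root[OF P_inf P_prime eps kappa gcd_cond val_bdd val_max
      a_mono a_growth b_bound]
  {
    assume lim: "limsup (\<lambda>n. ereal (\<bar>real_of_int (a n)\<bar> powr (1 / 2 ^ n))) = \<infinity>"
    \<comment> \<open>The base 2 of the hypothesis is \<open>D + 1\<close> for
      \<open>D = 1\<close>.\<close>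
    have unbdd: "\<exists>n\<ge>m. M * real (1 + 1) ^ n \<le> log 2 (real_of_int (a n))" for M m
    proof -
      obtain n where "n \<ge> max m 1" "M * 2 ^ n \<le> log 2 \<bar>real_of_int (a n)\<bar>"
        using limsup_root_infinite_imp_log_unbounded[OF lim, of "max m 1" M] a_pos by force
      then show ?thesis using a_pos[of n] by (intro exI[of _ n]) auto
    qed
    show "P_irrational P (\<lambda>n. real_of_int (a n) / real_of_int (b n))"
      unfolding P_irrational_def
    proof (intro conjI allI impI; (rule quot_nz)?)
      fix c :: "nat \<Rightarrow> int" assume c: "\<forall>n\<ge>1. \<forall>p\<in>P. \<not> int p dvd c n"
      let ?x = "\<Sum>n. 1 / (real_of_int (a (Suc n)) / real_of_int (b (Suc n)) * real_of_int (c (Suc n)))"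
      show "summable (\<lambda>n. 1 / (real_of_int (a (Suc n)) / real_of_int (b (Suc n)) * real_of_int (c (Suc n))))"
        by (rule series(1)[OF c])
      show "?x \<notin> \<rat>"
      proof
        assume "?x \<in> \<rat>"
        then obtain r s where x: "?x = real_of_int r / real_of_int s" and s: "0 < s"
          by (auto elim!: Rats_cases')
        \<comment> \<open>A rational value r/s is a root of this linear polynomial.\<close>
        let ?f = "[:- real_of_int r, real_of_int s:]"
        have "poly ?f ?x \<noteq> 0"
        proof (rule series(2)[OF c unbdd])
          show "coeff ?f i \<in> \<int>" for i by (auto simp: coeff_pCons split: nat.splits)
        qed (use s in auto)
        then show False unfolding x using s by simp
      qed
    qed
  }
  {
    assume lim: "\<forall>A::nat. A > 0 \<longrightarrow>
      limsup (\<lambda>n. ereal (real_of_int (a n) powr (1 / real A ^ n))) = \<infinity>"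
    show "P_transcendental P (\<lambda>n. real_of_int (a n) / real_of_int (b n))"
      unfolding P_transcendental_def
    proof (intro conjI allI impI; (rule quot_nz)?)
      fix c :: "nat \<Rightarrow> int" assume c: "\<forall>n\<ge>1. \<forall>p\<in>P. \<not> int p dvd c n"
      let ?x = "\<Sum>n. 1 / (real_of_int (a (Suc n)) / real_of_int (b (Suc n)) * real_of_int (c (Suc n)))"
      show "summable (\<lambda>n. 1 / (real_of_int (a (Suc n)) / real_of_int (b (Suc n)) * real_of_int (c (Suc n))))"
        by (rule series(1)[OF c])
      show "\<not> algebraic ?x"
      proof
        assume "algebraic ?x"
        then obtain f where f: "\<forall>i. coeff f i \<in> \<int>" "f \<noteq> 0" "poly f ?x = 0"
          unfolding algebraic_def by blast
        \<comment> \<open>The estimates assume \<open>1 \<le> D\<close>; the growth hypothesis is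
          then used with \<open>A = D + 1\<close>.\<close>
        define D where "D = max 1 (degree f)"
        have unbdd: "\<exists>n\<ge>m. M * real (D + 1) ^ n \<le> log 2 (real_of_int (a n))" for M m
          using lim a_pos by (intro limsup_root_infinite_imp_log_unbounded) auto
        have "poly f ?x \<noteq> 0"
          by (rule series(2)[OF c unbdd _ f(1)[rule_format] f(2)]) (auto simp: D_def)
        with f(3) show False by contradiction
      qed
    qed
  }
qed

end
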